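(* Let $r:\mathbb{N}\to\mathbb{N}$ be an increasing function which grows at least like $\log^{(i)}(N)$ for some integer $i>1$, i.e. there is $c>0$ with $r(N)\ge c\,\log^{(i)}(N)$ for all sufficiently large $N$. Then there exists a sequence $\{a_n : n\in\mathbb{N}\}$ of positive integers which satisfies $$\left|\{a_n\}\cap[1,N]\right|\le r(N)\log(N)\qquad\text{for all } N\in\mathbb{N},$$ such that for every $x\in\mathbb{R}\setminus\mathbb{Q}$ the set $\{a_nx : n\in\mathbb{N}\}$ is dense in $\mathbb{R}/\mathbb{Z}$.
   Context: $\mathbb{N}$ denotes the positive integers, $\log$ is the natural logarithm, and $\log^{(i)}$ denotes the $i$-fold iterated logarithm (defined for sufficiently large arguments). $|\{a_n\}\cap[1,N]|$ is the number of distinct elements of the sequence lying in $[1,N]$. A set of reals is said to be dense in $\mathbb{R}/\mathbb{Z}$ if its image modulo $1$ is dense. *)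

theory Defs
  imports "HOL-Analysis.Analysis"
begin

definition mod1_rel :: "(real \<times> real) set"
  where "mod1_rel = {(x, y). x - y \<in> \<int>}"

definition mod1 :: "real \<Rightarrow> real set"
  where "mod1 x = mod1_rel `` {x}"

text \<open>The space R/Z: the points are the classes of \<^const>\<open>mod1_rel\<close>, and a set of classes is open
  iff its preimage under \<^const>\<open>mod1\<close> is open in R (quotient topology).\<close>

definition real_mod1 :: "real set topology"
  where "real_mod1 = topology (\<lambda>U. U \<subseteq> UNIV // mod1_rel \<and> open (mod1 -` U))"

definition dense_mod1 :: "real set \<Rightarrow> bool"
  where "dense_mod1 S \<longleftrightarrow> real_mod1 closure_of (mod1 ` S) = topspace real_mod1"

lemma equiv_mod1_rel: "equiv UNIV mod1_rel"
proof (rule equivI)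
  show "sym mod1_rel"
    unfolding sym_def mod1_rel_def using Ints_minus by fastforce
  show "trans mod1_rel"
    unfolding trans_def mod1_rel_def
    by (clarsimp, metis Ints_add diff_add_cancel add_diff_eq)
qed (auto simp: refl_on_def mod1_rel_def)

lemma mod1_eq_iff: "mod1 x = mod1 y \<longleftrightarrow> x - y \<in> \<int>"
  using eq_equiv_class_iff[OF equiv_mod1_rel, of x y] by (simp add: mod1_def mod1_rel_def)

lemma range_mod1: "range mod1 = UNIV // mod1_rel"
  by (auto simp: mod1_def quotient_def)

lemma openin_real_mod1:
  "openin real_mod1 U \<longleftrightarrow> U \<subseteq> UNIV // mod1_rel \<and> open (mod1 -` U)"
proof -
  have "istopology (\<lambda>U. U \<subseteq> UNIV // mod1_rel \<and> open (mod1 -` U))"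
    unfolding istopology_def by (auto simp: vimage_Int vimage_Union)
  then show ?thesis
    by (simp add: real_mod1_def topology_inverse')
qed

lemma topspace_real_mod1: "topspace real_mod1 = UNIV // mod1_rel"
proof
  show "topspace real_mod1 \<subseteq> UNIV // mod1_rel"
    using openin_real_mod1 openin_topspace by blast
  have "mod1 -` (UNIV // mod1_rel) = UNIV"
    using range_mod1 by auto
  then show "UNIV // mod1_rel \<subseteq> topspace real_mod1"
    by (intro openin_subset) (simp add: openin_real_mod1)
qed

lemma quotient_map_mod1: "quotient_map euclideanreal real_mod1 mod1"
  unfolding quotient_map_def
  by (auto simp: topspace_real_mod1 range_mod1 openin_real_mod1 vimage_def)

end

theory Submission
  imports Defs
begin

text \<open>Fix a resolution \<open>1/Q\<close>. If \<open>x\<close> keeps a distance from the rationals with denominator at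
  most \<open>Q\<close>, then Dirichlet's theorem gives a bounded step \<open>d\<close> such that \<open>d * x\<close> is a rotation by
  roughly \<open>1/Q\<close>; hence in every long dyadic block a proportion \<open>1/(4Q)\<close> of the integers \<open>a\<close> brings
  \<open>a * x\<close> close to any prescribed target. There are about \<open>2 ^ K\<close> points \<open>x\<close> to distinguish
  when \<open>a < 2 ^ K\<close>, so a greedy choice of a large constant number of elements in each block up to
  \<open>2 ^ K\<close> eventually serves all of them. An irrational \<open>x\<close> has positive distance from the rationals with
  denominator at most \<open>Q\<close>, so running through all resolutions and all distances, each in a later
  range of blocks, yields the sequence. Since \<open>r\<close> tends to infinity, it
  exceeds the constant needed for a given resolution in all sufficiently late blocks.\<close>

section \<open>Nearness to integers and dyadic blocks\<close>

definition near_int :: "real \<Rightarrow> real \<Rightarrow> bool"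
  where "near_int e u \<longleftrightarrow> (\<exists>p::int. \<bar>u - of_int p\<bar> \<le> e)"

text \<open>The distance is measured at \<open>q * x\<close>, not between \<open>x\<close> and
  \<open>p / q\<close>: this is the quantity that Dirichlet's theorem bounds from above.\<close>

definition away_from_rats :: "nat \<Rightarrow> real \<Rightarrow> real \<Rightarrow> bool"
  where "away_from_rats Q \<delta> x \<longleftrightarrow> (\<forall>q\<in>{1..Q}. \<forall>p::int. \<delta> \<le> \<bar>real q * x - of_int p\<bar>)"

definition dyadic :: "nat \<Rightarrow> nat set"
  where "dyadic l = {2 ^ l..<2 ^ Suc l}"

lemma finite_dyadic [simp]: "finite (dyadic l)"
  by (simp add: dyadic_def)

lemma card_dyadic [simp]: "card (dyadic l) = 2 ^ l"
  by (simp add: dyadic_def)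

lemma dyadic_subset: "k \<le> l \<Longrightarrow> l < K \<Longrightarrow> dyadic l \<subseteq> {2 ^ k..<2 ^ K}"
proof -
  assume "k \<le> l" "l < K"
  then have "(2::nat) ^ k \<le> 2 ^ l" "(2::nat) ^ Suc l \<le> 2 ^ K"
    by (intro power_increasing; simp)+
  then show ?thesis by (auto simp: dyadic_def)
qed

lemma dyadic_disjoint: "l \<noteq> l' \<Longrightarrow> dyadic l \<inter> dyadic l' = {}"
proof (induction l l' rule: linorder_wlog)
  case (le l l')
  then have "dyadic l \<subseteq> {2 ^ l..<2 ^ l'}"
    by (intro dyadic_subset) auto
  then show ?case by (fastforce simp: dyadic_def)
qed (simp add: Int_commute)

lemma ex_dyadic:
  assumes "n \<ge> 1" shows "\<exists>l. n \<in> dyadic l"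
  using ex_power_ivl1[of 2 n] assms by (auto simp: dyadic_def)

section \<open>Rotations of the circle and hits in a dyadic block\<close>

text \<open>Steps of length \<gamma> cannot jump over an interval of length \<gamma>, and
  \<open>n\<close> of them go more than once around the circle.\<close>

lemma near_int_rotation:
  assumes "0 < \<gamma>" "1 < \<gamma> * n"
  shows "\<exists>j<n. near_int \<gamma> (y + real j * \<gamma>)"
proof -
  \<comment> \<open>\<open>s\<close> is the way up from \<open>y\<close> to the next integer, and
    \<open>j\<close> counts the full steps that fit into it.\<close>
  define s where "s = frac (- y)"
  define j where "j = nat \<lfloor>s / \<gamma>\<rfloor>"
  have s: "0 \<le> s" "s < 1" by (auto simp: s_def frac_lt_1)
  then have j: "real j \<le> s / \<gamma>" "s / \<gamma> < real j + 1"
    using assms by (auto simp: j_def)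
  have "real j * \<gamma> \<le> s" "s < real j * \<gamma> + \<gamma>"
    using j assms(1) by (auto simp: field_simps)
  moreover have "y + s = of_int (- \<lfloor>- y\<rfloor>)"
    by (simp add: s_def frac_def)
  ultimately have "\<bar>y + real j * \<gamma> - of_int (- \<lfloor>- y\<rfloor>)\<bar> \<le> \<gamma>"
    by linarith
  moreover have "j < n"
  proof -
    have "real j * \<gamma> < real n * \<gamma>"
      using \<open>real j * \<gamma> \<le> s\<close> s assms(2) by (simp add: mult.commute)
    then show ?thesis using assms(1) by simp
  qed
  ultimately show ?thesis unfolding near_int_def by blast
qed

lemma near_int_minus: "near_int e (- u) \<longleftrightarrow> near_int e u"
proof -
  have "near_int e u \<Longrightarrow> near_int e (- u)" for u
  proof -
    assume "near_int e u"
    then obtain p where "\<bar>u - of_int p\<bar> \<le> e" by (auto simp: near_int_def)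
    then have "\<bar>- u - of_int (- p)\<bar> \<le> e" by simp
    then show ?thesis unfolding near_int_def by blast
  qed
  from this[of u] this[of "- u"] show ?thesis by auto
qed

lemma near_int_rotation_abs:
  assumes "1 < \<bar>\<gamma>\<bar> * n"
  shows "\<exists>j<n. near_int \<bar>\<gamma>\<bar> (y + real j * \<gamma>)"
proof (cases "\<gamma> > 0")
  case True
  then show ?thesis using near_int_rotation[of \<gamma> n y] assms by simp
next
  case False
  moreover have "\<gamma> \<noteq> 0" using assms by auto
  ultimately obtain j where j: "j < n" "near_int (- \<gamma>) (- y + real j * (- \<gamma>))"
    using near_int_rotation[of "- \<gamma>" n "- y"] assms by auto
  have "- y + real j * (- \<gamma>) = - (y + real j * \<gamma>)" by simp
  then have "near_int \<bar>\<gamma>\<bar> (y + real j * \<gamma>)"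
    using j(2) False near_int_minus[of "- \<gamma>" "y + real j * \<gamma>"] by (metis abs_of_nonpos not_le less_imp_le)
  then show ?thesis using j(1) by blast
qed

lemma near_int_perturb:
  assumes "near_int e u" "\<bar>v - u - of_int p\<bar> \<le> e'"
  shows "near_int (e + e') v"
proof -
  obtain p' where "\<bar>u - of_int p'\<bar> \<le> e" using assms(1) by (auto simp: near_int_def)
  then have "\<bar>v - of_int (p + p')\<bar> \<le> e + e'" using assms(2) by simp
  then show ?thesis unfolding near_int_def by blast
qed

lemma near_int_mono: "near_int e u \<Longrightarrow> e \<le> e' \<Longrightarrow> near_int e' u"
  unfolding near_int_def by (meson order_trans)

text \<open>Dirichlet's theorem gives \<open>q\<close> for which \<open>q * x\<close> is a rotation
  by some \<beta> with \<delta> \<le> \<beta> < \<open>1 / Q\<close>. This may be far too slow, so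
  it is repeated \<open>h\<close> times until the angle lies between \<open>1 / (2 * Q)\<close> and
  \<open>1 / Q\<close>. Then \<open>2 * Q\<close> steps suffice for every start and target, and the
  lower bound on \<beta> keeps the step \<open>d\<close> bounded independently of
  \<open>x\<close>.\<close>

lemma uniform_return_step:
  assumes Q: "Q \<ge> 1" and "\<delta> > 0" and away: "away_from_rats Q \<delta> x"
  obtains d :: nat where "real d \<le> 1 / \<delta>"
    and "\<And>a t. \<exists>j<2 * Q. near_int (1 / Q) (real (a + j * d) * x - t)"
proof -
  obtain p q :: int where q: "0 < q" "q \<le> int Q" and pq: "\<bar>of_int q * x - of_int p\<bar> < 1 / Q"
    using Dirichlet_approx[of Q x] Q by (metis One_nat_def Suc_le_lessD)
  define \<beta> where "\<beta> = \<bar>of_int q * x - of_int p\<bar>"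
  have "nat q \<in> {1..Q}" using q by auto
  then have "\<delta> \<le> \<beta>"
    using away q unfolding away_from_rats_def \<beta>_def by fastforce
  then have "\<beta> > 0" using \<open>\<delta> > 0\<close> by simp
  \<comment> \<open>The largest multiplier with \<open>h * \<beta>\<close> at most
    \<open>1 / Q\<close>. It is at least 1 because \<beta> < \<open>1 / Q\<close>, so rounding down
    costs less than a factor of two.\<close>
  define h where "h = nat \<lfloor>1 / (Q * \<beta>)\<rfloor>"
  have "1 \<le> 1 / (Q * \<beta>)"
    using pq Q \<open>\<beta> > 0\<close> by (simp add: \<beta>_def field_simps)
  then have "real h = of_int \<lfloor>1 / (Q * \<beta>)\<rfloor>"
    unfolding h_def by (intro of_nat_nat) linarith
  then have h: "1 \<le> h" "real h \<le> 1 / (Q * \<beta>)" "1 / (Q * \<beta>) < real h + 1"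
    using \<open>1 \<le> 1 / (Q * \<beta>)\<close> by linarith+
  define d where "d = h * nat q"
  define \<gamma> where "\<gamma> = real d * x - of_int (int h * p)"
  have "\<gamma> = real h * (of_int q * x - of_int p)"
    using q by (simp add: \<gamma>_def d_def algebra_simps)
  then have \<gamma>: "\<bar>\<gamma>\<bar> = real h * \<beta>"
    by (simp add: \<beta>_def abs_mult)
  have \<gamma>_le: "\<bar>\<gamma>\<bar> \<le> 1 / Q"
    using h Q \<open>\<beta> > 0\<close> by (simp add: \<gamma> field_simps)
  have "1 / Q < 2 * \<bar>\<gamma>\<bar>"
  proof -
    have "1 / Q < (real h + 1) * \<beta>"
      using h(3) Q \<open>\<beta> > 0\<close> by (simp add: field_simps)
    also have "\<dots> \<le> (real h + real h) * \<beta>"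
      using h(1) \<open>\<beta> > 0\<close> by (intro mult_right_mono) auto
    finally show ?thesis by (simp add: \<gamma>)
  qed
  then have \<gamma>_ge: "1 < \<bar>\<gamma>\<bar> * (2 * Q)"
    using Q by (simp add: field_simps)
  have "real d \<le> 1 / \<delta>"
  proof -
    have "real d \<le> 1 / (Q * \<beta>) * Q"
      unfolding d_def using h(2) q \<open>\<beta> > 0\<close> by (simp only: of_nat_mult) (intro mult_mono, auto)
    also have "\<dots> = 1 / \<beta>" using Q by simp
    also have "\<dots> \<le> 1 / \<delta>" using \<open>\<delta> \<le> \<beta>\<close> \<open>\<delta> > 0\<close> by (simp add: frac_le)
    finally show ?thesis .
  qed
  moreover have "\<exists>j<2 * Q. near_int (1 / Q) (real (a + j * d) * x - t)" for a t
  proof -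
    obtain j where j: "j < 2 * Q" "near_int \<bar>\<gamma>\<bar> (real a * x - t + real j * \<gamma>)"
      using near_int_rotation_abs[of \<gamma> "2 * Q" "real a * x - t"] \<gamma>_ge by auto
    have "real (a + j * d) * x - t - (real a * x - t + real j * \<gamma>) = of_int (int j * (int h * p))"
      by (simp add: \<gamma>_def algebra_simps)
    \<comment> \<open>The two quantities differ exactly by an integer, so the perturbation error is
      zero.\<close>
    then have "near_int (\<bar>\<gamma>\<bar> + 0) (real (a + j * d) * x - t)"
      by (intro near_int_perturb[OF j(2), where p = "int j * (int h * p)"]) simp
    then show ?thesis using j(1) \<gamma>_le near_int_mono by auto
  qed
  ultimately show ?thesis by (rule that)
qed

text \<open>From each \<open>a\<close> in the lower half of the block, fewer than
  \<open>2 * Q\<close> steps of length \<open>d\<close> lead to a hit, and the size of the block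
  keeps this hit inside it. A hit is reached from at most one start for each number \<open>j\<close>
  of steps, so half the block is at most \<open>2 * Q\<close> times the number of hits.\<close>

lemma dyadic_hit_proportion:
  assumes Q: "Q \<ge> 1" and \<delta>: "\<delta> > 0" and away: "away_from_rats Q \<delta> x"
    and l: "4 * Q / \<delta> \<le> 2 ^ l"
  shows "2 ^ l \<le> 4 * Q * card {a \<in> dyadic l. near_int (1 / Q) (real a * x - t)}"
proof -
  obtain d :: nat where d: "real d \<le> 1 / \<delta>"
    and return: "\<And>a t. \<exists>j<2 * Q. near_int (1 / Q) (real (a + j * d) * x - t)"
    using uniform_return_step[OF Q \<delta> away] by blast
  define H where "H = {a \<in> dyadic l. near_int (1 / Q) (real a * x - t)}"
  have "finite H" by (simp add: H_def)
  have "real (4 * Q * d) \<le> 4 * Q * (1 / \<delta>)"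
    using d by (simp only: of_nat_mult) (intro mult_left_mono, auto)
  also have "\<dots> \<le> real (2 ^ l)" using l by simp
  finally have d4: "4 * Q * d \<le> 2 ^ l" by (simp only: of_nat_le_iff)
  define I :: "nat set" where "I = {a. 2 ^ l \<le> a \<and> 2 * a < 3 * 2 ^ l}"
  have "I \<subseteq> (\<Union>j<2 * Q. (\<lambda>h. h - j * d) ` H)"
  proof
    fix a assume a: "a \<in> I"
    obtain j where j: "j < 2 * Q" "near_int (1 / Q) (real (a + j * d) * x - t)"
      using return by blast
    have "j * d \<le> 2 * Q * d" using j(1) by (intro mult_right_mono) auto
    then have "2 * (j * d) \<le> 2 ^ l" using d4 by linarith
    moreover have "2 ^ l \<le> a" "2 * a < 3 * 2 ^ l" using a by (auto simp: I_def)
    ultimately have "a + j * d \<in> dyadic l"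
      unfolding dyadic_def atLeastLessThan_iff power_Suc by linarith
    then have "a + j * d \<in> H" using j(2) by (simp add: H_def)
    then show "a \<in> (\<Union>j<2 * Q. (\<lambda>h. h - j * d) ` H)"
      using j(1) by (intro UN_I[of j] image_eqI[of _ _ "a + j * d"]) auto
  qed
  then have "card I \<le> card (\<Union>j<2 * Q. (\<lambda>h. h - j * d) ` H)"
    using \<open>finite H\<close> by (intro card_mono) auto
  also have "\<dots> \<le> (\<Sum>j<2 * Q. card ((\<lambda>h. h - j * d) ` H))"
    by (intro card_UN_le) simp
  also have "\<dots> \<le> (\<Sum>j<2 * Q. card H)"
    using \<open>finite H\<close> by (intro sum_mono card_image_le)
  finally have "card I \<le> 2 * Q * card H" by simp
  moreover have "2 ^ l \<le> 2 * card I"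
  proof -
    \<comment> \<open>Rounding up half of \<open>2 ^ l\<close> also covers the one-element block
      \<open>l = 0\<close>.\<close>
    have "{2 ^ l..<2 ^ l + (2 ^ l + 1) div 2} \<subseteq> I" "finite I"
      by (auto simp: I_def intro: finite_subset[of _ "{..3 * 2 ^ l}"])
    then have "card {2 ^ l..<2 ^ l + (2 ^ l + 1) div 2 :: nat} \<le> card I"
      by (intro card_mono)
    then show ?thesis by simp
  qed
  ultimately show ?thesis by (simp add: H_def)
qed

section \<open>Greedy selection of hitting elements\<close>

text \<open>Double counting of the pairs \<open>(a, p)\<close> with \<open>hit a p\<close>: the
  average element of \<open>B\<close> hits a proportion \<open>1 / C\<close> of
  \<open>P\<close>.\<close>

lemma ex_popular:
  assumes "finite P" "finite B" "B \<noteq> {}"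
    and "\<And>p. p \<in> P \<Longrightarrow> card B \<le> C * card {a \<in> B. hit a p}"
  shows "\<exists>a\<in>B. card P \<le> C * card {p \<in> P. hit a p}"
proof (rule ccontr)
  assume "\<not> ?thesis"
  then have less: "C * card {p \<in> P. hit a p} < card P" if "a \<in> B" for a
    using that by (meson not_le)
  have "card P * card B = (\<Sum>p\<in>P. card B)" by simp
  also have "\<dots> \<le> (\<Sum>p\<in>P. C * card {a \<in> B. hit a p})"
    using assms by (intro sum_mono) auto
  also have "\<dots> = C * (\<Sum>p\<in>P. card {a \<in> B. hit a p})" by (simp add: sum_distrib_left)
  also have "(\<Sum>p\<in>P. card {a \<in> B. hit a p}) = (\<Sum>a\<in>B. card {p \<in> P. hit a p})"
    using sum_multicount_gen[of B P "\<lambda>a p. hit a p" "\<lambda>p. card {a \<in> B. hit a p}"] assms by simp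
  also have "C * \<dots> = (\<Sum>a\<in>B. C * card {p \<in> P. hit a p})" by (simp add: sum_distrib_left)
  also have "\<dots> < (\<Sum>a\<in>B. card P)"
    using assms less by (intro sum_strict_mono) auto
  finally show False by simp
qed

text \<open>Each new element is popular among the points still unhit, so it leaves at most the
  fraction \<open>1 - 1 / C\<close> of them.\<close>

lemma greedy_block:
  assumes "finite P" "finite B" "B \<noteq> {}" "C \<ge> 1"
    and many: "\<And>p. p \<in> P \<Longrightarrow> card B \<le> C * card {a \<in> B. hit a p}"
  shows "\<exists>A\<subseteq>B. card A \<le> n \<and>
     real (card {p \<in> P. \<forall>a\<in>A. \<not> hit a p}) \<le> (1 - 1 / real C) ^ n * real (card P)"
proof (induction n)
  case 0
  show ?case by (rule exI[of _ "{}"]) simp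
next
  case (Suc n)
  then obtain A where A: "A \<subseteq> B" "card A \<le> n"
    and unhit: "real (card {p \<in> P. \<forall>a\<in>A. \<not> hit a p}) \<le> (1 - 1 / real C) ^ n * real (card P)"
    by blast
  define R where "R = {p \<in> P. \<forall>a\<in>A. \<not> hit a p}"
  have "finite R" using assms(1) by (simp add: R_def)
  moreover have "\<And>p. p \<in> R \<Longrightarrow> card B \<le> C * card {a \<in> B. hit a p}"
    using many by (simp add: R_def)
  ultimately obtain b where b: "b \<in> B" "card R \<le> C * card {p \<in> R. hit b p}"
    using ex_popular[of R B C hit] assms by blast
  have "{p \<in> P. \<forall>a\<in>insert b A. \<not> hit a p} = R - {p \<in> R. hit b p}"
    by (auto simp: R_def)
  then have "real (card {p \<in> P. \<forall>a\<in>insert b A. \<not> hit a p}) = real (card R) - card {p \<in> R. hit b p}"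
    using \<open>finite R\<close> by (simp add: card_Diff_subset card_mono of_nat_diff)
  also have "\<dots> \<le> real (card R) - card R / C"
  proof -
    have "real (card R) \<le> C * real (card {p \<in> R. hit b p})"
      using b(2) by (metis of_nat_le_iff of_nat_mult)
    then show ?thesis using \<open>C \<ge> 1\<close> by (simp add: field_simps)
  qed
  also have "\<dots> = (1 - 1 / C) * card R" by (simp add: algebra_simps)
  also have "\<dots> \<le> (1 - 1 / C) * ((1 - 1 / real C) ^ n * real (card P))"
    using unhit \<open>C \<ge> 1\<close> by (intro mult_left_mono) (auto simp: R_def)
  finally have "real (card {p \<in> P. \<forall>a\<in>insert b A. \<not> hit a p})
      \<le> (1 - 1 / real C) ^ Suc n * real (card P)" by simp
  moreover have "card (insert b A) \<le> Suc n"
    using A finite_subset[OF A(1) \<open>finite B\<close>] by (simp add: card_insert_if)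
  ultimately show ?case using A(1) b(1) by (intro exI[of _ "insert b A"]) auto
qed

text \<open>The factor 4 per block matters: the net to be hit will grow only like
  \<open>2 ^ n\<close> in the number \<open>n\<close> of blocks, so \<open>4 ^ n\<close> eventually
  exceeds its size.\<close>

lemma greedy_blocks:
  assumes C: "C \<ge> 1" and M: "(1 - 1 / real C) ^ M < 1 / 4"
    and P: "finite P" and B: "\<And>l. finite (B l)" "\<And>l. B l \<noteq> {}"
    and many: "\<And>l p. p \<in> P \<Longrightarrow> card (B l) \<le> C * card {a \<in> B l. hit a p}"
  shows "\<exists>A. (\<forall>l. A l \<subseteq> B l \<and> card (A l) \<le> M)
    \<and> 4 ^ n * card {p \<in> P. \<forall>l<n. \<forall>a\<in>A l. \<not> hit a p} \<le> card P"
proof (induction n)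
  case 0
  show ?case by (rule exI[of _ "\<lambda>_. {}"]) simp
next
  case (Suc n)
  then obtain A where A: "\<And>l. A l \<subseteq> B l \<and> card (A l) \<le> M"
    and unhit: "4 ^ n * card {p \<in> P. \<forall>l<n. \<forall>a\<in>A l. \<not> hit a p} \<le> card P"
    by blast
  define R where "R = {p \<in> P. \<forall>l<n. \<forall>a\<in>A l. \<not> hit a p}"
  have "finite R" using P by (simp add: R_def)
  moreover have "\<And>p. p \<in> R \<Longrightarrow> card (B n) \<le> C * card {a \<in> B n. hit a p}"
    using many by (simp add: R_def)
  ultimately obtain A' where A': "A' \<subseteq> B n" "card A' \<le> M"
    "real (card {p \<in> R. \<forall>a\<in>A'. \<not> hit a p}) \<le> (1 - 1 / real C) ^ M * real (card R)"
    using greedy_block[of R "B n" C hit M] B C by blast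
  have "{p \<in> P. \<forall>l<Suc n. \<forall>a\<in>(A(n := A')) l. \<not> hit a p} = {p \<in> R. \<forall>a\<in>A'. \<not> hit a p}"
    by (auto simp: R_def less_Suc_eq)
  moreover have "4 * card {p \<in> R. \<forall>a\<in>A'. \<not> hit a p} \<le> card R"
  proof -
    have "(1 - 1 / real C) ^ M * real (card R) \<le> 1 / 4 * card R"
      using M by (intro mult_right_mono) auto
    then show ?thesis using A'(3) by linarith
  qed
  ultimately have "4 ^ Suc n * card {p \<in> P. \<forall>l<Suc n. \<forall>a\<in>(A(n := A')) l. \<not> hit a p}
      \<le> 4 ^ n * card R" by simp
  also have "\<dots> \<le> card P" using unhit by (simp add: R_def)
  finally show ?case
    using A A' by (intro exI[of _ "A(n := A')"] conjI) auto
qed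

section \<open>One stage: fixed resolution and fixed distance from the rationals\<close>

lemma grid_approx:
  assumes "D \<ge> 1"
  obtains j :: nat and p :: int where "j < D" "\<bar>x - j / D - of_int p\<bar> \<le> 1 / D"
proof -
  define j where "j = nat \<lfloor>frac x * D\<rfloor>"
  have "0 \<le> frac x" "frac x < 1" by (auto simp: frac_lt_1)
  then have j: "real j \<le> frac x * D" "frac x * D < real j + 1"
    by (auto simp: j_def)
  have "frac x * D < D" using \<open>frac x < 1\<close> assms by simp
  then have "j < D" using j(1) by linarith
  moreover have "\<bar>x - j / D - of_int \<lfloor>x\<rfloor>\<bar> \<le> 1 / D"
  proof -
    have "x - j / D - of_int \<lfloor>x\<rfloor> = (frac x * D - j) / D"
      using assms by (simp add: frac_def field_simps)
    then show ?thesis using j assms by (simp add: divide_right_mono)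
  qed
  ultimately show ?thesis by (rule that)
qed

text \<open>The pairs \<open>(x, t)\<close> are replaced by a finite net \<open>P\<close>, all of
  which the greedy selection hits within \<open>n\<close> blocks. The factor 2 in the block bound is
  reserved for passing from the number of blocks to the natural logarithm.\<close>

lemma stage:
  fixes r :: "nat \<Rightarrow> nat"
  assumes Q: "Q \<ge> 1" and unbounded: "\<And>M. \<forall>\<^sub>F l in sequentially. M \<le> r (2 ^ l)"
  shows "\<exists>K A. k < K \<and> A \<subseteq> {2 ^ k..<2 ^ K} \<and> (\<forall>l. 2 * card (A \<inter> dyadic l) \<le> r (2 ^ l)) \<and>
    (\<forall>x. away_from_rats Q (1 / Suc m) x \<longrightarrow> (\<forall>t. \<exists>a\<in>A. near_int (3 / Q) (real a * x - t)))"
proof -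
  obtain M where M: "(1 - 1 / real (4 * Q)) ^ M < 1 / 4"
    using real_arch_pow_inv[of "1 / 4" "1 - 1 / real (4 * Q)"] Q by auto
  obtain k0 where k0: "\<And>l. k0 \<le> l \<Longrightarrow> 2 * M \<le> r (2 ^ l)"
    using unbounded[of "2 * M"] by (auto simp: eventually_sequentially)
  \<comment> \<open>The first block must lie beyond \<open>k\<close>, must leave room for
    \<open>M\<close> elements under \<open>r\<close>, and must be long enough for the hit proportion
    at \<delta>, that is, \<open>2 ^ s\<close> is at least \<open>4 * Q / \<delta>\<close>.\<close>
  define s where "s = max k (max k0 (8 * Q * Suc m))"
  \<comment> \<open>This makes \<open>s + n + Suc (Q * Q)\<close> equal to \<open>2 * n\<close>,
    whence \<open>D * Q < 4 ^ n\<close>.\<close>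
  define n where "n = s + Suc (Q * Q)"
  \<comment> \<open>With this spacing, an \<open>a\<close> below \<open>2 ^ (s + n)\<close>
    magnifies the grid error in \<open>x\<close> to at most \<open>1 / Q\<close>.\<close>
  define D where "D = Q * 2 ^ (s + n)"
  \<comment> \<open>Half of the given distance; the other half absorbs the move from
    \<open>x\<close> to a grid point.\<close>
  define \<delta> where "\<delta> = 1 / (2 * real (Suc m))"
  have "\<delta> > 0" by (simp add: \<delta>_def)
  have "D \<ge> 1" using Q by (simp add: D_def)
  have s_large: "8 * Q * Suc m \<le> 2 ^ s"
  proof -
    have "8 * Q * Suc m \<le> s" unfolding s_def by (meson max.cobounded2 order_trans)
    then show ?thesis using less_exp[of s] by linarith
  qed
  define P where "P = {(j, i). j < D \<and> i < Q \<and> away_from_rats Q \<delta> (j / D)}"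
  define hit where "hit = (\<lambda>a (j, i). near_int (1 / Q) (real a * (real j / D) - real i / Q))"
  have "P \<subseteq> {..<D} \<times> {..<Q}" by (auto simp: P_def)
  then have "finite P" and "card P \<le> D * Q"
    using finite_subset[of P "{..<D} \<times> {..<Q}"] card_mono[of "{..<D} \<times> {..<Q}" P] by auto
  have many: "card (dyadic (s + l)) \<le> 4 * Q * card {a \<in> dyadic (s + l). hit a p}" if "p \<in> P" for l p
  proof -
    obtain j i where p: "p = (j, i)" by fastforce
    have "4 * Q / \<delta> = real (8 * Q * Suc m)" by (simp add: \<delta>_def algebra_simps)
    also have "\<dots> \<le> real (2 ^ s)" using s_large by (simp only: of_nat_le_iff)
    also have "\<dots> \<le> 2 ^ (s + l)" by (simp add: power_increasing)
    finally show ?thesis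
      using that dyadic_hit_proportion[OF Q \<open>\<delta> > 0\<close>, of "j / D" "s + l" "i / Q"]
      by (simp add: P_def hit_def p)
  qed
  have nonempty: "dyadic (s + l) \<noteq> {}" for l
    by (simp add: dyadic_def)
  have "\<exists>A. (\<forall>l. A l \<subseteq> dyadic (s + l) \<and> card (A l) \<le> M)
      \<and> 4 ^ n * card {p \<in> P. \<forall>l<n. \<forall>a\<in>A l. \<not> hit a p} \<le> card P"
    by (rule greedy_blocks[OF _ M \<open>finite P\<close> finite_dyadic nonempty many]) (use Q in simp)
  then obtain A where "\<forall>l. A l \<subseteq> dyadic (s + l) \<and> card (A l) \<le> M"
    and unhit: "4 ^ n * card {p \<in> P. \<forall>l<n. \<forall>a\<in>A l. \<not> hit a p} \<le> card P"
    by blast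
  then have A: "A l \<subseteq> dyadic (s + l)" "card (A l) \<le> M" for l by simp_all
  have "D * Q < 4 ^ n"
  proof -
    have "Q * Q < 2 ^ Suc (Q * Q)" using less_exp[of "Q * Q"] unfolding power_Suc by linarith
    then have "D * Q < 2 ^ (s + n) * 2 ^ Suc (Q * Q)" by (simp add: D_def algebra_simps)
    also have "\<dots> = 2 ^ (n + n)" by (simp add: n_def power_add)
    also have "\<dots> = 4 ^ n" by (simp add: power_add flip: power_mult_distrib)
    finally show ?thesis .
  qed
  \<comment> \<open>The number of unhit points is an integer below 1, hence zero.\<close>
  then have "4 ^ n * card {p \<in> P. \<forall>l<n. \<forall>a\<in>A l. \<not> hit a p} < 4 ^ n * 1"
    using unhit \<open>card P \<le> D * Q\<close> by linarith
  then have "card {p \<in> P. \<forall>l<n. \<forall>a\<in>A l. \<not> hit a p} = 0"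
    by (simp only: mult_less_cancel1) simp
  then have all_hit: "\<exists>l<n. \<exists>a\<in>A l. hit a p" if "p \<in> P" for p
    using that \<open>finite P\<close> by (cases p) auto
  define U where "U = (\<Union>l<n. A l)"
  have U: "U \<subseteq> {2 ^ s..<2 ^ (s + n)}"
    unfolding U_def
  proof (rule UN_least)
    fix l assume "l \<in> {..<n}"
    then show "A l \<subseteq> {2 ^ s..<2 ^ (s + n)}"
      by (intro order_trans[OF A(1)] dyadic_subset) auto
  qed
  have "2 * card (U \<inter> dyadic l) \<le> r (2 ^ l)" for l
  proof (cases "s \<le> l")
    case True
    \<comment> \<open>Disjointness of the blocks: only the selection made for block \<open>l\<close>
      can contribute to it.\<close>
    have "a \<in> A (l - s)" if "a \<in> A l'" "a \<in> dyadic l" for a l'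
      using that A(1)[of l'] dyadic_disjoint[of l "s + l'"] by (cases "l = s + l'") auto
    then have "U \<inter> dyadic l \<subseteq> A (l - s)" by (auto simp: U_def)
    then have "card (U \<inter> dyadic l) \<le> M"
      using A by (meson card_mono finite_dyadic finite_subset order_trans)
    moreover have "k0 \<le> l" using True by (simp add: s_def)
    ultimately show ?thesis using k0[of l] by simp
  next
    case False
    then have "dyadic l \<subseteq> {2 ^ 0..<2 ^ s}" by (intro dyadic_subset) auto
    then have "U \<inter> dyadic l = {}" using U by fastforce
    then show ?thesis by simp
  qed
  moreover have "\<exists>a\<in>U. near_int (3 / Q) (real a * x - t)"
    if away: "away_from_rats Q (1 / Suc m) x" for x t
  proof -
    obtain j p where j: "j < D" "\<bar>x - j / D - of_int p\<bar> \<le> 1 / D"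
      using grid_approx[OF \<open>D \<ge> 1\<close>] .
    obtain i p' where i: "i < Q" "\<bar>t - i / Q - of_int p'\<bar> \<le> 1 / Q"
      using grid_approx[OF Q] .
    have "away_from_rats Q \<delta> (j / D)"
      unfolding away_from_rats_def
    proof (intro ballI allI)
      fix q and p2 :: int assume q: "q \<in> {1..Q}"
      have "2 * \<delta> = 1 / Suc m" by (simp add: \<delta>_def divide_simps)
      \<comment> \<open>Since \<open>x\<close> is close to \<open>j / D + p\<close>, the numerator
        \<open>p2\<close> tested at the grid point corresponds to \<open>p2 + q * p\<close> at
        \<open>x\<close>.\<close>
      also have "\<dots> \<le> \<bar>real q * x - of_int (p2 + int q * p)\<bar>"
        using away q unfolding away_from_rats_def by blast
      also have "real q * x - of_int (p2 + int q * p)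
          = (real q * (j / D) - of_int p2) + real q * (x - j / D - of_int p)"
        by (simp add: algebra_simps)
      finally have "2 * \<delta> \<le> \<bar>real q * (j / D) - of_int p2\<bar> + \<bar>real q * (x - j / D - of_int p)\<bar>"
        by (rule order_trans) (rule abs_triangle_ineq)
      moreover have "\<bar>real q * (x - j / D - of_int p)\<bar> \<le> Q * (1 / D)"
        unfolding abs_mult using q j(2) by (intro mult_mono) auto
      moreover have "Q * (1 / D) \<le> \<delta>"
      proof -
        have "2 * Suc m \<le> 8 * Q * Suc m" using Q by (intro mult_right_mono) auto
        also have "\<dots> \<le> 2 ^ (s + n)"
          using s_large power_increasing[of s "s + n" "2::nat"] by linarith
        finally have "real (2 * Suc m) \<le> real (2 ^ (s + n))" by (simp only: of_nat_le_iff)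
        then have "1 / real (2 ^ (s + n)) \<le> 1 / real (2 * Suc m)" by (intro divide_left_mono) auto
        moreover have "Q * (1 / D) = 1 / real (2 ^ (s + n))" using Q by (simp add: D_def)
        moreover have "\<delta> = 1 / real (2 * Suc m)" by (simp add: \<delta>_def)
        ultimately show ?thesis by simp
      qed
      ultimately show "\<delta> \<le> \<bar>real q * (j / D) - of_int p2\<bar>" by linarith
    qed
    then have "(j, i) \<in> P" using j i by (simp add: P_def)
    then obtain l a where l: "l < n" "a \<in> A l" "hit a (j, i)"
      using all_hit by blast
    then have "a \<in> U" by (auto simp: U_def)
    then have "a \<le> 2 ^ (s + n)" using U by fastforce
    then have "real a \<le> real (2 ^ (s + n))" by (simp only: of_nat_le_iff)
    then have "real a * \<bar>x - j / D - of_int p\<bar> \<le> 2 ^ (s + n) * (1 / D)"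
      using j(2) by (intro mult_mono) auto
    also have "\<dots> = 1 / Q" by (simp add: D_def)
    finally have a: "\<bar>real a * (x - j / D - of_int p)\<bar> \<le> 1 / Q" by (simp add: abs_mult)
    have "real a * x - t - (real a * (j / D) - i / Q) - of_int (int a * p - p')
        = real a * (x - j / D - of_int p) - (t - i / Q - of_int p')"
      by (simp add: algebra_simps)
    then have "\<bar>real a * x - t - (real a * (j / D) - i / Q) - of_int (int a * p - p')\<bar> \<le> 1 / Q + 1 / Q"
      using a i(2) by linarith
    \<comment> \<open>The three errors come from the hit at the grid point, the grid for
      \<open>x\<close> and the grid for \<open>t\<close>.\<close>
    then have "near_int (1 / Q + (1 / Q + 1 / Q)) (real a * x - t)"
      using l(3) unfolding hit_def by (intro near_int_perturb) (simp_all only: prod.case)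
    moreover have "1 / Q + (1 / Q + 1 / Q) = 3 / Q" by simp
    ultimately show ?thesis using \<open>a \<in> U\<close> by metis
  qed
  moreover have "k < s + n" "U \<subseteq> {2 ^ k..<2 ^ (s + n)}"
  proof -
    have "k \<le> s" by (simp add: s_def)
    then have "(2::nat) ^ k \<le> 2 ^ s" by (intro power_increasing) auto
    then show "U \<subseteq> {2 ^ k..<2 ^ (s + n)}"
      using U by (meson atLeastLessThan_iff order_trans subset_iff)
    show "k < s + n" using \<open>k \<le> s\<close> by (simp add: n_def)
  qed
  ultimately show ?thesis by blast
qed

section \<open>Irrational points and density modulo 1\<close>

text \<open>Each \<open>q * x\<close> is outside the closed set of integers and so has positive
  distance from it; finitely many \<open>q\<close> share a lower bound.\<close>

lemma irrational_away_from_rats: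
  assumes "x \<notin> \<rat>"
  shows "\<exists>m. away_from_rats Q (1 / Suc m) x"
proof -
  have pos: "\<exists>m. \<forall>p::int. 1 / Suc m \<le> \<bar>real q * x - of_int p\<bar>" if "q \<ge> 1" for q
  proof -
    define u where "u = real q * x"
    have "u \<notin> \<int>"
    proof
      assume "u \<in> \<int>"
      then have "u / real q \<in> \<rat>" using Ints_subset_Rats by (intro Rats_divide) auto
      then show False using assms that by (simp add: u_def)
    qed
    then have "0 < setdist {u} \<int>"
      using setdist_gt_0_compact_closed[of "{u}" "\<int>"] Ints_0 by (auto simp: closed_Ints)
    then obtain m where "1 / Suc m < setdist {u} \<int>"
      using nat_approx_posE by blast
    moreover have "setdist {u} \<int> \<le> \<bar>u - of_int p\<bar>" for p
      using setdist_le_dist[of u "{u}" "of_int p" "\<int>"] by (simp add: dist_real_def)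
    ultimately show ?thesis unfolding u_def by (meson less_imp_le order_trans)
  qed
  show ?thesis
  proof (induction Q)
    case 0
    show ?case by (simp add: away_from_rats_def)
  next
    case (Suc Q)
    then obtain m where m: "away_from_rats Q (1 / Suc m) x" by blast
    obtain m' where m': "\<And>p::int. 1 / Suc m' \<le> \<bar>real (Suc Q) * x - of_int p\<bar>"
      using pos[of "Suc Q"] by auto
    have le: "1 / Suc (max m m') \<le> 1 / Suc m" "1 / Suc (max m m') \<le> 1 / Suc m'"
      by (auto intro!: divide_left_mono)
    have "away_from_rats (Suc Q) (1 / Suc (max m m')) x"
      unfolding away_from_rats_def
    proof (intro ballI allI)
      fix q and p :: int assume q: "q \<in> {1..Suc Q}"
      show "1 / Suc (max m m') \<le> \<bar>real q * x - of_int p\<bar>"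
      proof (cases "q = Suc Q")
        case True
        then show ?thesis using m'[of p] le(2) by (metis order_trans)
      next
        case False
        then have "1 / Suc m \<le> \<bar>real q * x - of_int p\<bar>"
          using m q by (auto simp: away_from_rats_def)
        then show ?thesis using le(1) by linarith
      qed
    qed
    then show ?case by blast
  qed
qed

text \<open>An open set of classes has an open preimage in the reals, which contains a ball around
  \<open>t\<close>; an integer shift brings \<open>s\<close> into this ball without changing its
  class.\<close>

lemma dense_mod1I:
  assumes "\<And>e t. e > 0 \<Longrightarrow> \<exists>s\<in>S. near_int e (s - t)"
  shows "dense_mod1 S"
proof -
  have "y \<in> real_mod1 closure_of (mod1 ` S)" if y: "y \<in> topspace real_mod1" for y
    unfolding in_closure_of
  proof (intro conjI allI impI y)
    fix U assume U: "y \<in> U \<and> openin real_mod1 U"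
    obtain t where t: "y = mod1 t" using y topspace_real_mod1 range_mod1 by blast
    have "open (mod1 -` U)" "t \<in> mod1 -` U" using U t by (auto simp: openin_real_mod1)
    then obtain e where e: "e > 0" "ball t e \<subseteq> mod1 -` U" by (meson open_contains_ball)
    obtain s p where s: "s \<in> S" "\<bar>s - t - of_int p\<bar> \<le> e / 2"
      using assms[of "e / 2" t] e(1) by (auto simp: near_int_def)
    then have "s - of_int p \<in> ball t e"
      using e(1) unfolding mem_ball dist_real_def by linarith
    then have "mod1 (s - of_int p) \<in> U" using e(2) by blast
    moreover have "mod1 (s - of_int p) = mod1 s" by (simp add: mod1_eq_iff)
    ultimately show "\<exists>y. y \<in> mod1 ` S \<and> y \<in> U" using s(1) by auto
  qed
  then show ?thesis
    unfolding dense_mod1_def by (intro equalityI closure_of_subset_topspace subsetI)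
qed

section \<open>Concatenating the stages\<close>

text \<open>Stages for all pairs \<open>(Q, m)\<close> follow one another, each starting at the
  exponent where the previous one ends. A block then meets at most one stage, so the bounds per
  block never add up.\<close>

lemma sparse_dense_set:
  fixes r :: "nat \<Rightarrow> nat"
  assumes unbounded: "\<And>M. \<forall>\<^sub>F l in sequentially. M \<le> r (2 ^ l)"
  obtains A :: "nat set" where "A \<subseteq> {2..}" "\<And>l. 2 * card (A \<inter> dyadic l) \<le> r (2 ^ l)"
    and "\<And>x. x \<notin> \<rat> \<Longrightarrow> dense_mod1 ((\<lambda>a. real a * x) ` A)"
proof -
  have "\<exists>K A. k < K \<and> A \<subseteq> {2 ^ k..<2 ^ K} \<and> (\<forall>l. 2 * card (A \<inter> dyadic l) \<le> r (2 ^ l)) \<and>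
      (\<forall>x. away_from_rats (Suc Q) (1 / Suc m) x \<longrightarrow>
        (\<forall>t. \<exists>a\<in>A. near_int (3 / Suc Q) (real a * x - t)))" for k Q m
    using stage[of "Suc Q" r k m] unbounded by simp
  then obtain K A where
    K: "\<And>k Q m. k < K k Q m" and
    A: "\<And>k Q m. A k Q m \<subseteq> {2 ^ k..<2 ^ K k Q m}"
       "\<And>k Q m l. 2 * card (A k Q m \<inter> dyadic l) \<le> r (2 ^ l)" and
    hits: "\<And>k Q m x t. away_from_rats (Suc Q) (1 / Suc m) x \<Longrightarrow>
        \<exists>a\<in>A k Q m. near_int (3 / Suc Q) (real a * x - t)"
    by metis
  \<comment> \<open>Starting at exponent 1 keeps the element 1 out of the set;
    \<open>prod_decode\<close> runs through all pairs \<open>(Q, m)\<close>.\<close>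
  define k where "k = rec_nat 1 (\<lambda>j k. K k (fst (prod_decode j)) (snd (prod_decode j)))"
  define S where "S = (\<lambda>j. A (k j) (fst (prod_decode j)) (snd (prod_decode j)))"
  have k_0: "k 0 = 1" and
    k_Suc: "k (Suc j) = K (k j) (fst (prod_decode j)) (snd (prod_decode j))" for j
    by (simp_all add: k_def)
  have k_mono: "k i \<le> k j" if "i \<le> j" for i j
    using that by (rule lift_Suc_mono_le[rotated]) (simp add: k_Suc K less_imp_le)
  have S: "S j \<subseteq> {2 ^ k j..<2 ^ k (Suc j)}" for j
    using A(1) by (simp add: S_def k_Suc)
  have S_separated: "S j \<inter> dyadic l = {}" if "i < j" "a \<in> S i" "a \<in> dyadic l" for a i j l
  proof -
    have "(2::nat) ^ l < 2 ^ k (Suc i)"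
      using that S[of i] unfolding dyadic_def by (meson atLeastLessThan_iff le_less_trans subsetD)
    then have "Suc l \<le> k (Suc i)" by simp
    also have "\<dots> \<le> k j" using \<open>i < j\<close> by (intro k_mono) simp
    finally have "(2::nat) ^ Suc l \<le> 2 ^ k j" by (intro power_increasing) auto
    then show ?thesis using S[of j] unfolding dyadic_def by fastforce
  qed
  have S_unique: "i = j" if "a \<in> S i" "b \<in> S j" "a \<in> dyadic l" "b \<in> dyadic l" for a b i j l
    using that S_separated[of i j a l] S_separated[of j i b l] by (metis IntI empty_iff nat_neq_iff)
  show ?thesis
  proof (rule that[of "\<Union>j. S j"])
    show "(\<Union>j. S j) \<subseteq> {2..}"
    proof
      fix a assume "a \<in> (\<Union>j. S j)"
      then obtain j where "2 ^ k j \<le> a" using S by fastforce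
      moreover have "(2::nat) ^ 1 \<le> 2 ^ k j"
        using k_mono[of 0 j] k_0 by (intro power_increasing) auto
      ultimately show "a \<in> {2..}" by simp
    qed
    show "2 * card ((\<Union>j. S j) \<inter> dyadic l) \<le> r (2 ^ l)" for l
    proof (cases "(\<Union>j. S j) \<inter> dyadic l = {}")
      case False
      then obtain j where "S j \<inter> dyadic l \<noteq> {}" by blast
      then have "(\<Union>j. S j) \<inter> dyadic l = S j \<inter> dyadic l"
        using S_unique by blast
      then show ?thesis using A(2) by (simp add: S_def)
    qed simp
    show "dense_mod1 ((\<lambda>a. real a * x) ` (\<Union>j. S j))" if x: "x \<notin> \<rat>" for x
    proof (rule dense_mod1I)
      fix e t :: real assume "e > 0"
      then obtain Q where "1 / Suc Q < e / 3"
        using nat_approx_posE[of "e / 3"] by auto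
      then have Q: "3 / Suc Q \<le> e" by (simp add: field_simps)
      obtain m where m: "away_from_rats (Suc Q) (1 / Suc m) x"
        using irrational_away_from_rats[OF x] by blast
      obtain a where "a \<in> S (prod_encode (Q, m))" "near_int (3 / Suc Q) (real a * x - t)"
        using hits[OF m] by (fastforce simp: S_def)
      then show "\<exists>s\<in>(\<lambda>a. real a * x) ` (\<Union>j. S j). near_int e (s - t)"
        using near_int_mono[OF _ Q] by blast
    qed
  qed
qed

section \<open>Counting elements and conclusion\<close>

lemma filterlim_ln_funpow: "filterlim (ln ^^ i :: real \<Rightarrow> real) at_top at_top"
proof (induction i)
  case (Suc i)
  then show ?case using filterlim_compose[OF ln_at_top] by (simp add: o_def)
qed (simp add: filterlim_ident id_def)

text \<open>If \<open>N\<close> lies in block \<open>K\<close>, each of the blocks 1 to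
  \<open>K\<close> contributes at most \<open>r N / 2\<close>, and \<open>K / 2\<close> \<le>
  \<open>K * ln 2\<close> \<le> \<open>ln N\<close>.\<close>

lemma card_Int_le_mult_ln:
  assumes A: "A \<subseteq> {2..}" and blocks: "\<And>l. 2 * card (A \<inter> dyadic l) \<le> r (2 ^ l)"
    and mono: "mono_on {1..} r" and "N \<ge> 1"
  shows "real (card (A \<inter> {1..N})) \<le> real (r N) * ln (real N)"
proof -
  obtain K where K: "N \<in> dyadic K" using ex_dyadic[OF \<open>N \<ge> 1\<close>] by blast
  then have "2 ^ K \<le> N" "N < 2 ^ Suc K" by (auto simp: dyadic_def)
  \<comment> \<open>Block 0 is left out because \<open>A\<close> does not contain 1. For
    \<open>N = 1\<close> this is forced, as \<open>ln N\<close> vanishes.\<close>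
  have "A \<inter> {1..N} \<subseteq> (\<Union>l\<in>{1..K}. A \<inter> dyadic l)"
  proof
    fix a assume a: "a \<in> A \<inter> {1..N}"
    then obtain l where l: "a \<in> dyadic l" using ex_dyadic[of a] by auto
    have "(2::nat) ^ l < 2 ^ Suc K" "(2::nat) ^ 1 < 2 ^ Suc l"
      using a l A \<open>N < 2 ^ Suc K\<close> by (auto simp: dyadic_def)
    then have "l < Suc K" "1 < Suc l"
      using nat_power_less_imp_less[OF pos2] by blast+
    then have "l \<in> {1..K}" by simp
    then show "a \<in> (\<Union>l\<in>{1..K}. A \<inter> dyadic l)" using a l by blast
  qed
  then have "card (A \<inter> {1..N}) \<le> card (\<Union>l\<in>{1..K}. A \<inter> dyadic l)"
    by (intro card_mono) auto
  also have "\<dots> \<le> (\<Sum>l\<in>{1..K}. card (A \<inter> dyadic l))" by (intro card_UN_le) simp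
  finally have "2 * card (A \<inter> {1..N}) \<le> (\<Sum>l\<in>{1..K}. 2 * card (A \<inter> dyadic l))"
    by (simp add: sum_distrib_left [symmetric])
  also have "\<dots> \<le> (\<Sum>l\<in>{1..K}. r N)"
  proof (rule sum_mono)
    fix l assume "l \<in> {1..K}"
    then have "(2::nat) ^ l \<le> 2 ^ K" by (intro power_increasing) auto
    then have "2 ^ l \<le> N" using \<open>2 ^ K \<le> N\<close> by (rule order_trans)
    then have "r (2 ^ l) \<le> r N"
      using \<open>N \<ge> 1\<close> by (intro mono_onD[OF mono]) auto
    then show "2 * card (A \<inter> dyadic l) \<le> r N" using blocks[of l] by simp
  qed
  finally have "real (2 * card (A \<inter> {1..N})) \<le> real (K * r N)" by (simp only: of_nat_le_iff) simp
  then have "real (card (A \<inter> {1..N})) \<le> real (r N) * (K * (1 / 2))" by (simp add: mult.commute)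
  also have "\<dots> \<le> real (r N) * (K * ln 2)"
    using ln2_ge_two_thirds by (intro mult_left_mono) auto
  also have "K * ln 2 = ln (2 ^ K)" by (simp add: ln_realpow)
  also have "real (r N) * ln (2 ^ K) \<le> real (r N) * ln (real N)"
  proof -
    have "real (2 ^ K) \<le> real N" using \<open>2 ^ K \<le> N\<close> by (simp only: of_nat_le_iff)
    then have "ln (2 ^ K) \<le> ln (real N)" by (intro ln_mono) auto
    then show ?thesis by (intro mult_left_mono) auto
  qed
  finally show ?thesis .
qed

theorem corollary4p10:
  fixes r :: "nat \<Rightarrow> nat" and i :: nat
  assumes r_pos: "\<And>N. N \<ge> 1 \<Longrightarrow> r N \<ge> 1"
    and r_mono: "mono_on {1..} r"
    and i_gt_1: "i > 1"
    and r_growth: "\<exists>c>0. \<forall>\<^sub>F N in sequentially. real (r N) \<ge> c * (ln ^^ i) (real N)"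
  shows "\<exists>a :: nat \<Rightarrow> nat.
      (\<forall>n\<ge>1. a n \<ge> 1) \<and>
      (\<forall>N\<ge>1. real (card (a ` {1..} \<inter> {1..N})) \<le> real (r N) * ln (real N)) \<and>
      (\<forall>x::real. x \<notin> \<rat> \<longrightarrow> dense_mod1 ((\<lambda>n. real (a n) * x) ` {1..}))"
proof -
  obtain c where "c > 0" and c: "\<forall>\<^sub>F N in sequentially. real (r N) \<ge> c * (ln ^^ i) (real N)"
    using r_growth by blast
  \<comment> \<open>The growth condition enters through its consequence that \<open>r\<close> tends
    to infinity, hence also along powers of two.\<close>
  have "filterlim (\<lambda>N. c * (ln ^^ i) (real N)) at_top sequentially"
    using \<open>c > 0\<close> filterlim_compose[OF filterlim_ln_funpow filterlim_real_sequentially]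
    by (intro filterlim_tendsto_pos_mult_at_top[OF tendsto_const]) auto
  then have "filterlim (\<lambda>N. real (r N)) at_top sequentially"
    using c by (rule filterlim_at_top_mono)
  then have "filterlim r at_top sequentially"
    by (simp add: filterlim_sequentially_iff_filterlim_real)
  moreover have "filterlim (\<lambda>l. 2 ^ l :: nat) at_top sequentially"
    by (rule filterlim_at_top_mono[OF filterlim_ident]) (simp add: less_imp_le)
  ultimately have "filterlim (\<lambda>l. r (2 ^ l)) at_top sequentially"
    by (rule filterlim_compose)
  then have "\<And>M. \<forall>\<^sub>F l in sequentially. M \<le> r (2 ^ l)"
    by (simp add: filterlim_at_top)
  then obtain A where A: "A \<subseteq> {2..}" "\<And>l. 2 * card (A \<inter> dyadic l) \<le> r (2 ^ l)"
    and dense: "\<And>x. x \<notin> \<rat> \<Longrightarrow> dense_mod1 ((\<lambda>a. real a * x) ` A)"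
    using sparse_dense_set by blast
  \<comment> \<open>An element \<open>a0\<close> is needed to fill the indices outside
    \<open>A\<close>.\<close>
  have "A \<noteq> {}"
  proof
    assume "A = {}"
    obtain x :: real where "x \<notin> \<rat>"
      using countable_rat uncountable_UNIV_real by (metis UNIV_eq_I)
    then have "topspace real_mod1 = {}"
      using dense \<open>A = {}\<close> by (simp add: dense_mod1_def)
    then show False using topspace_real_mod1 range_mod1 by blast
  qed
  then obtain a0 where "a0 \<in> A" by blast
  \<comment> \<open>Only the set of values matters, so \<open>a\<close> fixes \<open>A\<close>
    pointwise and repeats \<open>a0\<close> elsewhere.\<close>
  define a where "a = (\<lambda>n. if n \<in> A then n else a0)"
  have "n \<in> a ` {1..}" if "n \<in> A" for n
    using that A(1) by (intro image_eqI[of _ _ n]) (auto simp: a_def)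
  then have range_a: "a ` {1..} = A" using \<open>a0 \<in> A\<close> by (auto simp: a_def)
  have "a n \<ge> 1" for n using A(1) \<open>a0 \<in> A\<close> by (auto simp: a_def)
  moreover have "real (card (A \<inter> {1..N})) \<le> real (r N) * ln (real N)" if "N \<ge> 1" for N
    using card_Int_le_mult_ln[OF A r_mono that] .
  moreover have "dense_mod1 ((\<lambda>n. real (a n) * x) ` {1..})" if "x \<notin> \<rat>" for x
  proof -
    have "(\<lambda>n. real (a n) * x) ` {1..} = (\<lambda>a. real a * x) ` A"
      by (simp only: image_image flip: range_a)
    then show ?thesis using dense[OF that] by simp
  qed
  ultimately show ?thesis using range_a by (intro exI[of _ a]) auto
qed

end
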